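(* For every $L\in\mathfrak{g}^J$ and every $p\in\mathbb{S}^J$, $$\big\langle\Psi(p),\mathbf{Q}(L)\Psi(p)\big\rangle=\mathbf{J}^L(p),$$ where $\Psi:\mathbb{S}^J\to L^2(\mathbb{R})$ is the map $\Psi(p)(x)=\exp\{\frac12(z_1x+z_2x^2-\psi(\theta))\}$ and $\mathbf{Q}$, $\mathbf{J}$ are the linear map and the momentum map specified in the context.
   Context: The Siegel-Jacobi space $\mathbb{S}^J$ is $\mathbb{H}\times\mathbb{C}$ ($\mathbb{H}$ the upper half-plane) with points $(\tau,z)$. Coordinates $(\theta_1,\theta_2,\dot\theta_1,\dot\theta_2)$ on $\mathbb{S}^J$ ($\theta_2<0$) are defined by $\tau=\dot\theta_2-i\theta_2$, $z=-\dot\theta_1+i\theta_1$; $z_k=\theta_k+i\dot\theta_k$; $\eta_1=-\frac{\theta_1}{2\theta_2}$, $\eta_2=\frac{\theta_1^2-2\theta_2}{4\theta_2^2}$; and $\psi(\theta)=-\frac{\theta_1^2}{4\theta_2}+\frac12\ln\big(-\frac{\pi}{\theta_2}\big)$. On $L^2(\mathbb{R})$, $\langle f,g\rangle=\int_{\mathbb{R}}\bar f g\,dx$. $\mathfrak{g}^J=\mathfrak{sl}(2,\mathbb{R})\times\mathbb{R}^2\times\mathbb{R}$ is the Lie algebra of the Jacobi group, with basis $F=\big[\begin{smallmatrix}0&1\\0&0\end{smallmatrix}\big]$, $G=\big[\begin{smallmatrix}0&0\\1&0\end{smallmatrix}\big]$, $H=\big[\begin{smallmatrix}1&0\\0&-1\end{smallmatrix}\big]$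 in $\mathfrak{sl}(2,\mathbb{R})$, $P=(1,0,0)$, $Q=(0,1,0)$, $R=(0,0,1)$ in $\mathbb{R}^2\times\mathbb{R}$. The momentum map $\mathbf{J}:\mathbb{S}^J\to(\mathfrak{g}^J)^*$, with $\mathbf{J}^L(p)=\mathbf{J}(p)(L)$, is determined by linearity in $L$ and $\mathbf{J}^F=-\eta_2$, $\mathbf{J}^G=\frac14\dot\theta_1^2+\eta_2\dot\theta_2^2+\eta_1\dot\theta_1\dot\theta_2-\frac{1}{4(\eta_1^2-\eta_2)}$, $\mathbf{J}^H=-\eta_1\dot\theta_1-2\eta_2\dot\theta_2$, $\mathbf{J}^P=\frac12\dot\theta_1+\eta_1\dot\theta_2$, $\mathbf{J}^Q=\eta_1$, $\mathbf{J}^R=-\frac14$. $\mathbf{Q}:\mathfrak{g}^J\to\mathrm{End}(C^\infty(\mathbb{R},\mathbb{C}))$ is the $\mathbb{R}$-linear map with $\mathbf{Q}(F)=-x^2$, $\mathbf{Q}(G)=-\frac{\partial^2}{\partial x^2}$, $\mathbf{Q}(H)=2i\big(x\frac{\partial}{\partial x}+\frac12I\big)$, $\mathbf{Q}(P)=-i\frac{\partial}{\partial x}$, $\mathbf{Q}(Q)=x$, $\mathbf{Q}(R)=-\frac14I$ ($-x^2$ and $x$ acting by multiplication, $I$ the identity). *)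

theory Defs
  imports "HOL-Analysis.Analysis"
begin

section \<open>The Siegel-Jacobi space and its coordinates\<close>

definition siegel_jacobi :: "(complex \<times> complex) set" where
  "siegel_jacobi = {\<tau>. Im \<tau> > 0} \<times> UNIV"

text \<open>The four coordinate functions solve \<open>\<tau> = \<theta>\<^sub>2' - \<i> \<theta>\<^sub>2\<close> and \<open>z = - \<theta>\<^sub>1' + \<i> \<theta>\<^sub>1\<close>, where a prime stands
  for the dot of the usual notation; see \<open>siegel_jacobi_coordinates\<close> below.\<close>

definition theta1 :: "complex \<times> complex \<Rightarrow> real" where
  "theta1 p = Im (snd p)"

definition theta2 :: "complex \<times> complex \<Rightarrow> real" where
  "theta2 p = - Im (fst p)"

definition theta1_dot :: "complex \<times> complex \<Rightarrow> real" where
  "theta1_dot p = - Re (snd p)"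

definition theta2_dot :: "complex \<times> complex \<Rightarrow> real" where
  "theta2_dot p = Re (fst p)"

lemma siegel_jacobi_coordinates:
  "fst p = of_real (theta2_dot p) - \<i> * of_real (theta2 p)"
  "snd p = - of_real (theta1_dot p) + \<i> * of_real (theta1 p)"
  by (simp_all add: complex_eq_iff theta1_def theta2_def theta1_dot_def theta2_dot_def)

lemma siegel_jacobi_iff: "p \<in> siegel_jacobi \<longleftrightarrow> theta2 p < 0"
  by (auto simp: siegel_jacobi_def theta2_def mem_Times_iff)

definition z1 :: "complex \<times> complex \<Rightarrow> complex" where
  "z1 p = of_real (theta1 p) + \<i> * of_real (theta1_dot p)"

definition z2 :: "complex \<times> complex \<Rightarrow> complex" where
  "z2 p = of_real (theta2 p) + \<i> * of_real (theta2_dot p)"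

definition eta1 :: "complex \<times> complex \<Rightarrow> real" where
  "eta1 p = - theta1 p / (2 * theta2 p)"

definition eta2 :: "complex \<times> complex \<Rightarrow> real" where
  "eta2 p = ((theta1 p)\<^sup>2 - 2 * theta2 p) / (4 * (theta2 p)\<^sup>2)"

definition psi :: "complex \<times> complex \<Rightarrow> real" where
  "psi p = - (theta1 p)\<^sup>2 / (4 * theta2 p) + 1 / 2 * ln (- pi / theta2 p)"


section \<open>Function spaces\<close>

text \<open>Elements of \<open>L\<^sup>2(\<real>)\<close> are represented by functions rather than by classes modulo null sets;
  the pairing depends only on the classes.\<close>

definition L2 :: "(real \<Rightarrow> complex) set" where
  "L2 = {f \<in> borel_measurable lborel. integrable lborel (\<lambda>x. (cmod (f x))\<^sup>2)}"

definition L2_inner :: "(real \<Rightarrow> complex) \<Rightarrow> (real \<Rightarrow> complex) \<Rightarrow> complex" where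
  "L2_inner f g = (LINT x|lborel. cnj (f x) * g x)"

definition ddx :: "(real \<Rightarrow> complex) \<Rightarrow> real \<Rightarrow> complex" where
  "ddx f = (\<lambda>x. vector_derivative f (at x))"

definition smooth_functions :: "(real \<Rightarrow> complex) set" where
  "smooth_functions = {f. \<forall>n x. (ddx ^^ n) f differentiable (at x)}"

lemma smooth_functions_coinduct:
  assumes "f \<in> A"
    and A: "\<And>g. g \<in> A \<Longrightarrow> ddx g \<in> A" "\<And>g x. g \<in> A \<Longrightarrow> g differentiable (at x)"
  shows "f \<in> smooth_functions"
proof -
  have "(ddx ^^ n) f \<in> A" for n
    by (induction n) (use assms in auto)
  then show ?thesis
    by (auto simp: smooth_functions_def intro: A)
qed

lemma ddx_smooth:
  assumes "f \<in> smooth_functions"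
  shows "ddx f \<in> smooth_functions"
proof -
  have "(ddx ^^ n) (ddx f) differentiable (at x)" for n x
    using assms unfolding smooth_functions_def
    by (metis (mono_tags, lifting) comp_apply funpow_Suc_right mem_Collect_eq)
  then show ?thesis
    by (simp add: smooth_functions_def)
qed

lemma smooth_has_vector_derivative:
  assumes "f \<in> smooth_functions"
  shows "(f has_vector_derivative ddx f x) (at x)"
proof -
  have "(ddx ^^ 0) f differentiable (at x)"
    using assms unfolding smooth_functions_def by blast
  then show ?thesis
    by (simp add: ddx_def vector_derivative_works)
qed

lemma ddx_eqI:
  assumes "\<And>x. (f has_vector_derivative f' x) (at x)"
  shows "ddx f = f'"
  using assms by (auto simp: ddx_def intro: vector_derivative_at)

lemma ddx_add:
  assumes "f \<in> smooth_functions" "g \<in> smooth_functions"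
  shows "ddx (\<lambda>x. f x + g x) = (\<lambda>x. ddx f x + ddx g x)"
  using assms by (intro ddx_eqI has_vector_derivative_add smooth_has_vector_derivative)

lemma ddx_cmult:
  assumes "f \<in> smooth_functions"
  shows "ddx (\<lambda>x. c * f x) = (\<lambda>x. c * ddx f x)"
  using assms by (intro ddx_eqI has_vector_derivative_mult_right smooth_has_vector_derivative)

lemma smooth_add:
  assumes "f \<in> smooth_functions" "g \<in> smooth_functions"
  shows "(\<lambda>x. f x + g x) \<in> smooth_functions"
proof (rule smooth_functions_coinduct)
  let ?A = "{\<lambda>x. f x + g x |f g. f \<in> smooth_functions \<and> g \<in> smooth_functions}"
  have der: "((\<lambda>x. f x + g x) has_vector_derivative ddx f x + ddx g x) (at x)"
    if "f \<in> smooth_functions" "g \<in> smooth_functions" for f g x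
    using that by (intro has_vector_derivative_add smooth_has_vector_derivative)
  show "(\<lambda>x. f x + g x) \<in> ?A"
    using assms by blast
  show "ddx h \<in> ?A" if "h \<in> ?A" for h
    using that ddx_eqI[OF der] ddx_smooth by fastforce
  show "h differentiable (at x)" if "h \<in> ?A" for h x
    using that der by (auto simp: has_vector_derivative_def differentiable_def)
qed

lemma smooth_cmult:
  assumes "f \<in> smooth_functions"
  shows "(\<lambda>x. c * f x) \<in> smooth_functions"
proof (rule smooth_functions_coinduct)
  let ?A = "{\<lambda>x. c * f x |f. f \<in> smooth_functions}"
  have der: "((\<lambda>x. c * f x) has_vector_derivative c * ddx f x) (at x)"
    if "f \<in> smooth_functions" for f x
    using that by (intro has_vector_derivative_mult_right smooth_has_vector_derivative)
  show "(\<lambda>x. c * f x) \<in> ?A"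
    using assms by blast
  show "ddx h \<in> ?A" if "h \<in> ?A" for h
    using that ddx_eqI[OF der] ddx_smooth by fastforce
  show "h differentiable (at x)" if "h \<in> ?A" for h x
    using that der by (auto simp: has_vector_derivative_def differentiable_def)
qed

lemma smooth_mult_ident:
  assumes "f \<in> smooth_functions"
  shows "(\<lambda>x. of_real x * f x) \<in> smooth_functions"
proof (rule smooth_functions_coinduct)
  let ?A = "{\<lambda>x. of_real x * f x + g x |f g. f \<in> smooth_functions \<and> g \<in> smooth_functions}"
  have der: "((\<lambda>x. of_real x * f x + g x) has_vector_derivative
      of_real x * ddx f x + (f x + ddx g x)) (at x)"
    if "f \<in> smooth_functions" "g \<in> smooth_functions" for f g x
    using that
    by (auto intro!: derivative_eq_intros smooth_has_vector_derivative has_vector_derivative_of_real)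
  have "(\<lambda>x. 0) \<in> smooth_functions"
    using smooth_cmult[OF assms, of 0] by simp
  with assms show "(\<lambda>x. of_real x * f x) \<in> ?A"
    by (intro CollectI exI[of _ f] exI[of _ "\<lambda>x. 0"]) auto
  show "ddx h \<in> ?A" if "h \<in> ?A" for h
  proof -
    obtain f g where h: "h = (\<lambda>x. of_real x * f x + g x)"
      and fg: "f \<in> smooth_functions" "g \<in> smooth_functions"
      using \<open>h \<in> ?A\<close> by auto
    have "ddx h = (\<lambda>x. of_real x * ddx f x + (f x + ddx g x))"
      unfolding h by (intro ddx_eqI der fg)
    then show ?thesis
      using smooth_add[OF fg(1) ddx_smooth[OF fg(2)]] ddx_smooth[OF fg(1)] by auto
  qed
  show "h differentiable (at x)" if "h \<in> ?A" for h x
    using that der by (auto simp: has_vector_derivative_def differentiable_def)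
qed


section \<open>The Lie algebra of the Jacobi group\<close>

type_synonym jacobi_vec = "(real^2^2) \<times> (real \<times> real) \<times> real"

definition jacobi_algebra :: "jacobi_vec set" where
  "jacobi_algebra = {X. trace X = 0} \<times> UNIV \<times> UNIV"

definition basis_F :: jacobi_vec where
  "basis_F = (vector [vector [0, 1], vector [0, 0]], (0, 0), 0)"

definition basis_G :: jacobi_vec where
  "basis_G = (vector [vector [0, 0], vector [1, 0]], (0, 0), 0)"

definition basis_H :: jacobi_vec where
  "basis_H = (vector [vector [1, 0], vector [0, - 1]], (0, 0), 0)"

definition basis_P :: jacobi_vec where
  "basis_P = (0, (1, 0), 0)"

definition basis_Q :: jacobi_vec where
  "basis_Q = (0, (0, 1), 0)"

definition basis_R :: jacobi_vec where
  "basis_R = (0, (0, 0), 1)"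

lemmas basis_defs = basis_F_def basis_G_def basis_H_def basis_P_def basis_Q_def basis_R_def

text \<open>Coordinates with respect to the basis above; the coordinate of \<open>H\<close> is the entry \<open>X $ 1 $ 1\<close>,
  since the trace vanishes.\<close>

definition coord_F :: "jacobi_vec \<Rightarrow> real" where "coord_F L = fst L $ 1 $ 2"
definition coord_G :: "jacobi_vec \<Rightarrow> real" where "coord_G L = fst L $ 2 $ 1"
definition coord_H :: "jacobi_vec \<Rightarrow> real" where "coord_H L = fst L $ 1 $ 1"
definition coord_P :: "jacobi_vec \<Rightarrow> real" where "coord_P L = fst (fst (snd L))"
definition coord_Q :: "jacobi_vec \<Rightarrow> real" where "coord_Q L = snd (fst (snd L))"
definition coord_R :: "jacobi_vec \<Rightarrow> real" where "coord_R L = snd (snd L)"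

lemmas coord_defs = coord_F_def coord_G_def coord_H_def coord_P_def coord_Q_def coord_R_def

lemma coord_add:
  "coord_F (K + L) = coord_F K + coord_F L" "coord_G (K + L) = coord_G K + coord_G L"
  "coord_H (K + L) = coord_H K + coord_H L" "coord_P (K + L) = coord_P K + coord_P L"
  "coord_Q (K + L) = coord_Q K + coord_Q L" "coord_R (K + L) = coord_R K + coord_R L"
  by (simp_all add: coord_defs)

lemma coord_scaleR:
  "coord_F (c *\<^sub>R L) = c * coord_F L" "coord_G (c *\<^sub>R L) = c * coord_G L"
  "coord_H (c *\<^sub>R L) = c * coord_H L" "coord_P (c *\<^sub>R L) = c * coord_P L"
  "coord_Q (c *\<^sub>R L) = c * coord_Q L" "coord_R (c *\<^sub>R L) = c * coord_R L"
  by (simp_all add: coord_defs)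

lemma subspace_jacobi_algebra: "subspace jacobi_algebra"
  by (auto simp: subspace_def jacobi_algebra_def trace_def sum.distrib zero_prod_def
      simp flip: sum_distrib_left)

lemma basis_in_jacobi_algebra:
  "basis_F \<in> jacobi_algebra" "basis_G \<in> jacobi_algebra" "basis_H \<in> jacobi_algebra"
  "basis_P \<in> jacobi_algebra" "basis_Q \<in> jacobi_algebra" "basis_R \<in> jacobi_algebra"
  by (simp_all add: basis_defs jacobi_algebra_def trace_def sum_2 vector_2)

lemma jacobi_algebra_expansion:
  assumes "L \<in> jacobi_algebra"
  shows "L = coord_F L *\<^sub>R basis_F + coord_G L *\<^sub>R basis_G + coord_H L *\<^sub>R basis_H
    + coord_P L *\<^sub>R basis_P + coord_Q L *\<^sub>R basis_Q + coord_R L *\<^sub>R basis_R"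
proof -
  obtain X a b r where L: "L = (X, (a, b), r)"
    by (metis prod.collapse)
  have "X $ 2 $ 2 = - (X $ 1 $ 1)"
    using assms by (simp add: L jacobi_algebra_def trace_def sum_2)
  then show ?thesis
    by (simp add: L coord_defs basis_defs vec_eq_iff forall_2 vector_2)
qed


section \<open>The momentum map and the quantization map\<close>

definition momentum :: "complex \<times> complex \<Rightarrow> jacobi_vec \<Rightarrow> real" where
  "momentum p L =
     coord_F L * (- eta2 p)
   + coord_G L * (1 / 4 * (theta1_dot p)\<^sup>2 + eta2 p * (theta2_dot p)\<^sup>2
        + eta1 p * theta1_dot p * theta2_dot p - 1 / (4 * ((eta1 p)\<^sup>2 - eta2 p)))
   + coord_H L * (- eta1 p * theta1_dot p - 2 * eta2 p * theta2_dot p)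
   + coord_P L * (1 / 2 * theta1_dot p + eta1 p * theta2_dot p)
   + coord_Q L * eta1 p
   + coord_R L * (- 1 / 4)"

definition quantization :: "jacobi_vec \<Rightarrow> (real \<Rightarrow> complex) \<Rightarrow> real \<Rightarrow> complex" where
  "quantization L f = (\<lambda>x.
     of_real (coord_F L) * (- (of_real x)\<^sup>2 * f x)
   + of_real (coord_G L) * (- ddx (ddx f) x)
   + of_real (coord_H L) * (2 * \<i> * (of_real x * ddx f x + 1 / 2 * f x))
   + of_real (coord_P L) * (- \<i> * ddx f x)
   + of_real (coord_Q L) * (of_real x * f x)
   + of_real (coord_R L) * (- 1 / 4 * f x))"

lemma linear_momentum: "linear (momentum p)"
  by (rule linearI) (simp_all add: momentum_def coord_defs algebra_simps add_divide_distrib)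

lemma momentum_basis:
  "momentum p basis_F = - eta2 p"
  "momentum p basis_G = 1 / 4 * (theta1_dot p)\<^sup>2 + eta2 p * (theta2_dot p)\<^sup>2
     + eta1 p * theta1_dot p * theta2_dot p - 1 / (4 * ((eta1 p)\<^sup>2 - eta2 p))"
  "momentum p basis_H = - eta1 p * theta1_dot p - 2 * eta2 p * theta2_dot p"
  "momentum p basis_P = 1 / 2 * theta1_dot p + eta1 p * theta2_dot p"
  "momentum p basis_Q = eta1 p"
  "momentum p basis_R = - 1 / 4"
  by (simp_all add: momentum_def coord_defs basis_defs vector_2)

lemma quantization_linear:
  "quantization (K + L) f = (\<lambda>x. quantization K f x + quantization L f x)"
  "quantization (c *\<^sub>R L) f = (\<lambda>x. c *\<^sub>R quantization L f x)"
  by (simp_all add: quantization_def coord_add coord_scaleR scaleR_conv_of_real algebra_simps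
      add_divide_distrib)

lemma quantization_basis:
  "quantization basis_F f = (\<lambda>x. - (of_real x)\<^sup>2 * f x)"
  "quantization basis_G f = (\<lambda>x. - ddx (ddx f) x)"
  "quantization basis_H f = (\<lambda>x. 2 * \<i> * (of_real x * ddx f x + 1 / 2 * f x))"
  "quantization basis_P f = (\<lambda>x. - \<i> * ddx f x)"
  "quantization basis_Q f = (\<lambda>x. of_real x * f x)"
  "quantization basis_R f = (\<lambda>x. - 1 / 4 * f x)"
  by (simp_all add: quantization_def coord_defs basis_defs vector_2)

lemma quantization_smooth:
  assumes "f \<in> smooth_functions"
  shows "quantization L f \<in> smooth_functions"
proof -
  note closure = smooth_add smooth_cmult smooth_mult_ident ddx_smooth assms
  have F: "(\<lambda>x. of_real (coord_F L) * (- 1 * (of_real x * (of_real x * f x)))) \<in> smooth_functions"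
    by (intro closure)
  have G: "(\<lambda>x. of_real (coord_G L) * (- 1 * ddx (ddx f) x)) \<in> smooth_functions"
    by (intro closure)
  have "(\<lambda>x. of_real (coord_F L) * (- 1 * (of_real x * (of_real x * f x)))
      + of_real (coord_G L) * (- 1 * ddx (ddx f) x)
      + of_real (coord_H L) * (2 * \<i> * (of_real x * ddx f x + 1 / 2 * f x))
      + of_real (coord_P L) * (- \<i> * ddx f x)
      + of_real (coord_Q L) * (of_real x * f x)
      + of_real (coord_R L) * (- 1 / 4 * f x)) \<in> smooth_functions"
    by (intro F G closure)
  then show ?thesis
    by (simp add: quantization_def power2_eq_square mult.assoc)
qed

lemma quantization_endomorphism:
  assumes "f \<in> smooth_functions" "g \<in> smooth_functions"
  shows "quantization L (\<lambda>x. f x + g x) = (\<lambda>x. quantization L f x + quantization L g x)"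
    and "quantization L (\<lambda>x. c * f x) = (\<lambda>x. c * quantization L f x)"
  using assms
  by (simp_all add: quantization_def ddx_add ddx_cmult ddx_smooth algebra_simps add_divide_distrib)


section \<open>The map into the Hilbert space\<close>

definition Psi :: "complex \<times> complex \<Rightarrow> real \<Rightarrow> complex" where
  "Psi p = (\<lambda>x. exp (1 / 2 * (z1 p * of_real x + z2 p * (of_real x)\<^sup>2 - of_real (psi p))))"

lemma Psi_smooth: "Psi p \<in> smooth_functions"
proof (rule smooth_functions_coinduct)
  let ?A = "range (\<lambda>q x. poly q (of_real x) * Psi p x)"
  have der: "((\<lambda>x. poly q (of_real x) * Psi p x) has_vector_derivative
      poly (pderiv q + q * [:z1 p / 2, z2 p:]) (of_real x) * Psi p x) (at x)" for q x
  proof -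
    have "((\<lambda>w. poly q w * exp (1 / 2 * (z1 p * w + z2 p * w\<^sup>2 - of_real (psi p))))
        has_field_derivative poly (pderiv q + q * [:z1 p / 2, z2 p:]) (of_real x) * Psi p x)
        (at (of_real x))"
      unfolding Psi_def
      by (rule derivative_eq_intros poly_DERIV refl)+ (simp add: field_simps)
    then show ?thesis
      unfolding Psi_def by (rule has_vector_derivative_real_field)
  qed
  show "Psi p \<in> ?A"
    by (rule range_eqI[of _ _ 1]) (simp add: fun_eq_iff)
  show "ddx h \<in> ?A" if "h \<in> ?A" for h
  proof -
    obtain q where h: "h = (\<lambda>x. poly q (of_real x) * Psi p x)"
      using \<open>h \<in> ?A\<close> by auto
    show ?thesis
      unfolding h ddx_eqI[OF der] by (rule rangeI)
  qed
  show "h differentiable (at x)" if "h \<in> ?A" for h x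
    using that der by (auto simp: has_vector_derivative_def differentiable_def)
qed

end

theory Submission
  imports Defs "HOL-Probability.Distributions"
begin

text \<open>The density \<open>\<bar>\<Psi>(p)\<bar>\<^sup>2\<close> is the normal density of mean \<open>\<eta>\<^sub>1\<close> and second moment \<open>\<eta>\<^sub>2\<close>, and every
  \<open>\<^bold>Q(L)\<close> multiplies \<open>\<Psi>(p)\<close> by a quadratic polynomial in \<open>x\<close>. The pairing is therefore read off from
  the first two moments; its imaginary part cancels because of \<open>\<theta>\<^sub>1 + 2 \<theta>\<^sub>2 \<eta>\<^sub>1 = 0\<close> and
  \<open>\<theta>\<^sub>1 \<eta>\<^sub>1 + 2 \<theta>\<^sub>2 \<eta>\<^sub>2 = -1\<close>.\<close>

text \<open>Central moments of the normal density are integrable, so \<open>q\<close> is re-expanded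
  in powers of \<open>x - \<mu>\<close>.\<close>

lemma integrable_normal_density_poly:
  assumes "\<sigma> > 0"
  shows "integrable lborel (\<lambda>x. normal_density \<mu> \<sigma> x * poly q x)"
proof -
  \<comment> \<open>The shift \<open>r(y) = q(y + \<mu>)\<close> has the Taylor coefficients of
    \<open>q\<close> at \<open>\<mu>\<close> as its coefficients.\<close>
  define r where "r = pcompose q [:\<mu>, 1:]"
  have "poly q x = (\<Sum>k\<le>degree r. coeff r k * (x - \<mu>) ^ k)" for x
  proof -
    have "poly q x = poly r (x - \<mu>)"
      by (simp add: r_def poly_pcompose)
    then show ?thesis
      by (simp add: poly_altdef)
  qed
  then have "(\<lambda>x. normal_density \<mu> \<sigma> x * poly q x) =
      (\<lambda>x. \<Sum>k\<le>degree r. coeff r k * (normal_density \<mu> \<sigma> x * (x - \<mu>) ^ k))"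
    by (simp add: sum_distrib_left mult.left_commute)
  then show ?thesis
    using integrable_normal_moment[OF assms] by simp
qed

lemma integral_normal_density_quadratic:
  fixes a b c :: complex
  assumes "\<sigma> > 0"
  shows "(LINT x|lborel. of_real (normal_density \<mu> \<sigma> x) * (a + b * of_real x + c * (of_real x)\<^sup>2))
    = a + b * of_real \<mu> + c * of_real (\<mu>\<^sup>2 + \<sigma>\<^sup>2)"
proof -
  let ?N = "normal_density \<mu> \<sigma>"
  have int: "integrable lborel (\<lambda>x. ?N x * x ^ k)" for k
    using integrable_normal_density_poly[OF assms, of \<mu> "monom 1 k"] by (simp add: poly_monom)
  have 0: "(LINT x|lborel. ?N x) = 1"
    using integral_normal_density[OF assms] .
  have 1: "(LINT x|lborel. ?N x * x) = \<mu>"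
    using integral_normal_moment_nz_1[OF assms] .
  \<comment> \<open>The variance is the central moment of order \<open>2 * 1\<close>; expanding its
    square below turns it into the raw second moment.\<close>
  have "(LINT x|lborel. ?N x * (x - \<mu>)\<^sup>2) = \<sigma>\<^sup>2"
    using integral_normal_moment_even[OF assms, of \<mu> 1] by (simp add: fact_numeral)
  moreover have "(LINT x|lborel. ?N x * (x - \<mu>)\<^sup>2) =
      (LINT x|lborel. ?N x * x\<^sup>2) - 2 * \<mu> * (LINT x|lborel. ?N x * x) + \<mu>\<^sup>2 * (LINT x|lborel. ?N x)"
  proof -
    have "?N x * (x - \<mu>)\<^sup>2 = ?N x * x\<^sup>2 - 2 * \<mu> * (?N x * x) + \<mu>\<^sup>2 * ?N x" for x
      by (simp add: power2_eq_square algebra_simps)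
    then show ?thesis
      using int[of 0] int[of 1] int[of 2] by simp
  qed
  ultimately have 2: "(LINT x|lborel. ?N x * x\<^sup>2) = \<mu>\<^sup>2 + \<sigma>\<^sup>2"
    by (simp add: 0 1 power2_eq_square)
  have "of_real (?N x) * (a + b * of_real x + c * (of_real x)\<^sup>2) =
      a * of_real (?N x) + b * of_real (?N x * x) + c * of_real (?N x * x\<^sup>2)" for x
    by (simp add: algebra_simps)
  moreover have "integrable lborel (\<lambda>x. complex_of_real (?N x * x ^ k))" for k
    using int[of k] by (simp only: complex_of_real_integrable_eq)
  note this[of 0] this[of 1] this[of 2]
  ultimately show ?thesis
    by (simp add: 0 1 2 del: of_real_mult of_real_power of_real_add)
qed

text \<open>The dotted coordinates only affect the phase and cancel. Completing the square leaves a
  Gaussian, and \<open>psi\<close> is exactly the logarithm of its total mass.\<close>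

lemma cnj_Psi_times_Psi:
  assumes "p \<in> siegel_jacobi"
  shows "cnj (Psi p x) * Psi p x =
    of_real (normal_density (eta1 p) (sqrt (- 1 / (2 * theta2 p))) x)"
proof -
  let ?t = "theta2 p"
  have t: "?t < 0"
    using assms by (simp add: siegel_jacobi_iff)
  have "cnj (Psi p x) * Psi p x = exp (of_real (theta1 p * x + ?t * x\<^sup>2 - psi p))"
    unfolding Psi_def z1_def z2_def exp_cnj exp_add[symmetric]
    by (rule arg_cong[where f = exp]) (simp add: field_simps)
  also have "\<dots> = of_real (exp (theta1 p * x + ?t * x\<^sup>2 - psi p))"
    by (simp only: exp_of_real)
  also have "exp (theta1 p * x + ?t * x\<^sup>2 - psi p) =
      exp (theta1 p * x + ?t * x\<^sup>2 + (theta1 p)\<^sup>2 / (4 * ?t)) / sqrt (- pi / ?t)"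
  proof -
    have "- pi / ?t > 0"
      using t by (intro divide_neg_neg) simp_all
    then have "exp (1 / 2 * ln (- pi / ?t)) = exp (ln (sqrt (- pi / ?t)))"
      by (simp only: ln_sqrt less_imp_le) simp
    also have "\<dots> = sqrt (- pi / ?t)"
      using \<open>- pi / ?t > 0\<close> by (simp only: exp_ln real_sqrt_gt_zero)
    finally have "exp (1 / 2 * ln (- pi / ?t)) = sqrt (- pi / ?t)" .
    moreover have "theta1 p * x + ?t * x\<^sup>2 - psi p =
        theta1 p * x + ?t * x\<^sup>2 + (theta1 p)\<^sup>2 / (4 * ?t) - 1 / 2 * ln (- pi / ?t)"
      by (simp add: psi_def)
    ultimately show ?thesis
      by (simp only: exp_diff)
  qed
  \<comment> \<open>The rational term of \<open>psi\<close> is the constant that completes the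
    square.\<close>
  also have "theta1 p * x + ?t * x\<^sup>2 + (theta1 p)\<^sup>2 / (4 * ?t) = ?t * (x - eta1 p)\<^sup>2"
    using t by (simp add: eta1_def field_simps power2_eq_square)
  also have "exp (?t * (x - eta1 p)\<^sup>2) / sqrt (- pi / ?t) =
      normal_density (eta1 p) (sqrt (- 1 / (2 * ?t))) x"
  \<comment> \<open>With this variance, \<open>1 / (2 * \<sigma>\<^sup>2) = - theta2 p\<close> and
    \<open>2 * pi * \<sigma>\<^sup>2 = - pi / theta2 p\<close>.\<close>
  proof -
    have "(sqrt (- 1 / (2 * ?t)))\<^sup>2 = - 1 / (2 * ?t)"
      using t by (simp add: divide_nonneg_neg divide_nonpos_neg)
    then show ?thesis
      unfolding normal_density_def by (simp add: mult.commute)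
  qed
  finally show ?thesis .
qed

text \<open>Covers both \<open>Psi p\<close> and its images under \<open>quantization\<close>:
  square integrability is that of a normal density times a quartic, and the pairing is a combination
  of moments.\<close>

lemma Psi_times_quadratic:
  fixes a b c :: complex
  assumes "p \<in> siegel_jacobi"
  defines "f \<equiv> \<lambda>x. (a + b * of_real x + c * (of_real x)\<^sup>2) * Psi p x"
  shows "f \<in> L2" and "L2_inner (Psi p) f = a + b * of_real (eta1 p) + c * of_real (eta2 p)"
proof -
  define \<sigma> where "\<sigma> = sqrt (- 1 / (2 * theta2 p))"
  have t: "theta2 p < 0"
    using assms by (simp add: siegel_jacobi_iff)
  then have \<sigma>: "\<sigma> > 0"
    by (simp add: \<sigma>_def divide_neg_neg)
  note dens = cnj_Psi_times_Psi[OF assms(1), folded \<sigma>_def]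
  \<comment> \<open>At real \<open>x\<close>, the real and imaginary parts of the complex quadratic
    are real polynomials.\<close>
  have "(cmod (f x))\<^sup>2 = normal_density (eta1 p) \<sigma> x *
      poly ([:Re a, Re b, Re c:]\<^sup>2 + [:Im a, Im b, Im c:]\<^sup>2) x" for x
  proof -
    have "of_real ((cmod (Psi p x))\<^sup>2) = complex_of_real (normal_density (eta1 p) \<sigma> x)"
      unfolding dens[symmetric] complex_norm_square by (simp add: mult.commute)
    then have "(cmod (Psi p x))\<^sup>2 = normal_density (eta1 p) \<sigma> x"
      by (simp only: of_real_eq_iff)
    moreover have "(cmod (a + b * of_real x + c * (of_real x)\<^sup>2))\<^sup>2 =
        poly ([:Re a, Re b, Re c:]\<^sup>2 + [:Im a, Im b, Im c:]\<^sup>2) x"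
      unfolding cmod_power2 by (simp add: algebra_simps power2_eq_square)
    ultimately show ?thesis
      by (simp add: f_def norm_mult power_mult_distrib)
  qed
  then have "integrable lborel (\<lambda>x. (cmod (f x))\<^sup>2)"
    using integrable_normal_density_poly[OF \<sigma>] by presburger
  moreover have "f \<in> borel_measurable lborel"
    unfolding f_def Psi_def measurable_lborel2
    by (intro borel_measurable_continuous_onI continuous_intros)
  ultimately show "f \<in> L2"
    by (simp add: L2_def)
  have "cnj (Psi p x) * f x =
      of_real (normal_density (eta1 p) \<sigma> x) * (a + b * of_real x + c * (of_real x)\<^sup>2)" for x
    unfolding dens[symmetric] f_def by (simp add: mult_ac)
  moreover have "(eta1 p)\<^sup>2 + \<sigma>\<^sup>2 = eta2 p"
    using t by (simp add: \<sigma>_def eta1_def eta2_def divide_nonneg_neg divide_nonpos_neg field_simps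
        power2_eq_square)
  ultimately show "L2_inner (Psi p) f = a + b * of_real (eta1 p) + c * of_real (eta2 p)"
    using integral_normal_density_quadratic[OF \<sigma>, of "eta1 p" a b c]
    by (simp add: L2_inner_def)
qed

lemma ddx_Psi: "ddx (Psi p) = (\<lambda>x. (z1 p / 2 + z2 p * of_real x) * Psi p x)"
proof (rule ddx_eqI)
  fix x
  have "((\<lambda>w. exp (1 / 2 * (z1 p * w + z2 p * w\<^sup>2 - of_real (psi p)))) has_field_derivative
      (z1 p / 2 + z2 p * of_real x) * Psi p x) (at (of_real x))"
    unfolding Psi_def by (rule derivative_eq_intros refl)+ (simp add: field_simps)
  then show "(Psi p has_vector_derivative (z1 p / 2 + z2 p * of_real x) * Psi p x) (at x)"
    unfolding Psi_def by (rule has_vector_derivative_real_field)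
qed

text \<open>If \<open>u' = q u\<close>, then \<open>u'' = (q\<^sup>2 + q') u\<close>; here
  \<open>q' = z2 p\<close>.\<close>

lemma ddx_ddx_Psi:
  "ddx (ddx (Psi p)) = (\<lambda>x. ((z1 p / 2 + z2 p * of_real x)\<^sup>2 + z2 p) * Psi p x)"
proof (rule ddx_eqI)
  fix x
  note [derivative_intros] = smooth_has_vector_derivative[OF Psi_smooth]
  show "(ddx (Psi p) has_vector_derivative ((z1 p / 2 + z2 p * of_real x)\<^sup>2 + z2 p) * Psi p x) (at x)"
    unfolding ddx_Psi
    by (auto intro!: derivative_eq_intros has_vector_derivative_of_real
        simp: ddx_Psi power2_eq_square field_simps)
qed

text \<open>The logarithmic derivative of \<open>Psi p\<close> is linear in \<open>x\<close>, so no
  generator produces degree above two. Terms are grouped by powers of \<open>x\<close> to fit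
  \<open>Psi_times_quadratic\<close>.\<close>

lemma quantization_Psi:
  "quantization L (Psi p) = (\<lambda>x.
    ((- coord_G L * ((z1 p)\<^sup>2 / 4 + z2 p) + coord_H L * \<i> - coord_P L * \<i> * z1 p / 2 - coord_R L / 4)
     + (- coord_G L * z1 p * z2 p + coord_H L * \<i> * z1 p - coord_P L * \<i> * z2 p + coord_Q L) * of_real x
     + (- coord_F L - coord_G L * (z2 p)\<^sup>2 + coord_H L * 2 * \<i> * z2 p) * (of_real x)\<^sup>2) * Psi p x)"
  unfolding quantization_def ddx_ddx_Psi unfolding ddx_Psi
  by (simp add: fun_eq_iff field_simps power2_eq_square)

theorem proposition4p5:
  fixes L :: jacobi_vec and p :: "complex \<times> complex"
  assumes "L \<in> jacobi_algebra"
    and "p \<in> siegel_jacobi"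
  shows "Psi p \<in> L2 \<and> quantization L (Psi p) \<in> L2 \<and>
    L2_inner (Psi p) (quantization L (Psi p)) = complex_of_real (momentum p L)"
proof (intro conjI)
  show "Psi p \<in> L2"
    using Psi_times_quadratic(1)[OF assms(2), of 1 0 0] by simp
  show "quantization L (Psi p) \<in> L2"
    unfolding quantization_Psi by (rule Psi_times_quadratic(1)[OF assms(2)])
  have t: "theta2 p \<noteq> 0"
    using assms(2) by (simp add: siegel_jacobi_iff)
  \<comment> \<open>Eliminating \<open>theta1\<close> and \<open>eta2\<close> leaves
    \<open>eta1\<close>, \<open>theta2\<close> and the dotted coordinates. The fraction in the
    \<open>G\<close> component then collapses, since
    \<open>(eta1 p)\<^sup>2 - eta2 p = 1 / (2 * theta2 p)\<close>.\<close>
  have 1: "theta1 p = - 2 * theta2 p * eta1 p"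
    using t by (simp add: eta1_def)
  have 2: "eta2 p = (eta1 p)\<^sup>2 - 1 / (2 * theta2 p)"
    using t by (simp add: eta1_def eta2_def field_simps power2_eq_square)
  show "L2_inner (Psi p) (quantization L (Psi p)) = complex_of_real (momentum p L)"
    unfolding quantization_Psi Psi_times_quadratic(2)[OF assms(2)] momentum_def z1_def z2_def 1 2
    using t by (simp add: complex_eq_iff power2_eq_square) (simp add: field_simps)
qed

end
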